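(* Let $\Phi$ be an Orlicz function satisfying $$\limsup_{t\to 0_+}\frac{\Phi(2t)}{\Phi(t)}<+\infty,$$ let $k\ge 0$ be a real number, and let $w=(w_m)_{m\in\mathbb{Z}}$ be a sequence of weights with $w_m>0$ for every $m\in\mathbb{Z}$ and $\inf_{m\in\mathbb{Z}}w_m>0$. Then the following statements hold. (a) We have $$\mathsf{s}_{k,\Phi,w}=\mathsf{c}_{k,\Phi,w}=l_{k,\Phi,w},$$ and this common space is a separable Banach space relative to the norm $\|\cdot\|_{k,\Phi,w}$, which consists of all complex sequences $\mathsf{p}=(p_m)_{m\in\mathbb{Z}}$ such that $$\sum_{m\in\mathbb{Z}}w_m(1+\Phi(|m|))^k\,\Phi(|p_m|)<+\infty.$$ (b) If in addition $k'\in\mathbb{R}$ satisfies the strict inequality $k'>k$, then the embedding $$\mathsf{s}_{k',\Phi,w}\rightarrow\mathsf{s}_{k,\Phi,w}$$ is compact.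
   Context: An Orlicz function is a continuous, non-decreasing, convex function $\Phi:[0,+\infty)\to[0,+\infty)$ with $\Phi(0)=0$, $\Phi(t)>0$ for every $t>0$ and $\lim_{t\to+\infty}\Phi(t)=+\infty$. Given such $\Phi$, positive weights $w=(w_m)_{m\in\mathbb{Z}}$ and $k\in\mathbb{R}$, the class $\mathsf{c}_{k,\Phi,w}$ is the set of all complex sequences $\mathsf{p}=(p_m)_{m\in\mathbb{Z}}$ satisfying $\sum_{m\in\mathbb{Z}}w_m(1+\Phi(|m|))^k\,\Phi(|p_m|)<+\infty$. For a complex sequence $\mathsf{p}$ put $$\|\mathsf{p}\|_{k,\Phi,w}:=\inf\Big\{\rho>0:\ \sum_{m\in\mathbb{Z}}w_m(1+\Phi(|m|))^k\,\Phi\Big(\frac{|p_m|}{\rho}\Big)\le 1\Big\}$$ (with $\inf\emptyset=+\infty$). The space $l_{k,\Phi,w}$ is the set of all complex sequences with $\|\mathsf{p}\|_{k,\Phi,w}<+\infty$, and $\mathsf{s}_{k,\Phi,w}$ is its vector subspace consisting of all complex sequences $\mathsf{p}$ such that $\sum_{m\in\mathbb{Z}}w_m(1+\Phi(|m|))^k\,\Phi(|p_m|/\rho)<+\infty$ for every $\rho>0$; both are equipped with the norm $\|\cdot\|_{k,\Phi,w}$. For $k'\ge k$ one has $\mathsf{s}_{k',\Phi,w}\subseteq\mathsf{s}_{k,\Phi,w}$, and the embedding $\mathsf{s}_{k',\Phi,w}\rightarrow\mathsf{s}_{k,\Phi,w}$ is the inclusion map. An embedding is compact if the inclusion map is a compact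 linear operator, i.e. maps bounded sets to relatively compact sets. *)

theory Defs
  imports "HOL-Analysis.Analysis" "HOL-Library.Function_Algebras"
begin

text \<open>
  Orlicz functions live on the half-line; the values of the Isabelle function on negative
  arguments are irrelevant.
\<close>

definition orlicz_function :: "(real \<Rightarrow> real) \<Rightarrow> bool" where
  "orlicz_function \<Phi> \<longleftrightarrow>
     \<Phi> \<in> {0..} \<rightarrow> {0..} \<and> continuous_on {0..} \<Phi> \<and> mono_on {0..} \<Phi> \<and> convex_on {0..} \<Phi> \<and>
     \<Phi> 0 = 0 \<and> (\<forall>t>0. \<Phi> t > 0) \<and> filterlim \<Phi> at_top at_top"

text \<open>
  For weights and \<open>a\<close> nonnegative, every summand is nonnegative, so \<^const>\<open>ennreal\<close> truncates
  nothing and the sum always exists in \<open>[0, \<infinity>]\<close>.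
\<close>

definition orlicz_sum ::
    "real \<Rightarrow> (real \<Rightarrow> real) \<Rightarrow> (int \<Rightarrow> real) \<Rightarrow> (int \<Rightarrow> real) \<Rightarrow> ennreal" where
  "orlicz_sum k \<Phi> w a =
     (\<Sum>\<^sub>\<infinity>m\<in>UNIV. ennreal (w m * (1 + \<Phi> (real_of_int \<bar>m\<bar>)) powr k * \<Phi> (a m)))"

definition orlicz_class ::
    "real \<Rightarrow> (real \<Rightarrow> real) \<Rightarrow> (int \<Rightarrow> real) \<Rightarrow> (int \<Rightarrow> complex) set" where
  "orlicz_class k \<Phi> w = {p. orlicz_sum k \<Phi> w (\<lambda>m. cmod (p m)) < \<infinity>}"

text \<open>In \<^typ>\<open>ennreal\<close> the infimum of the empty set is \<open>\<infinity>\<close>.\<close>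

definition orlicz_enorm ::
    "real \<Rightarrow> (real \<Rightarrow> real) \<Rightarrow> (int \<Rightarrow> real) \<Rightarrow> (int \<Rightarrow> complex) \<Rightarrow> ennreal" where
  "orlicz_enorm k \<Phi> w p =
     Inf {ennreal \<rho> | \<rho>. \<rho> > 0 \<and> orlicz_sum k \<Phi> w (\<lambda>m. cmod (p m) / \<rho>) \<le> 1}"

definition orlicz_space ::
    "real \<Rightarrow> (real \<Rightarrow> real) \<Rightarrow> (int \<Rightarrow> real) \<Rightarrow> (int \<Rightarrow> complex) set" where
  "orlicz_space k \<Phi> w = {p. orlicz_enorm k \<Phi> w p < \<infinity>}"

definition small_orlicz_space ::
    "real \<Rightarrow> (real \<Rightarrow> real) \<Rightarrow> (int \<Rightarrow> real) \<Rightarrow> (int \<Rightarrow> complex) set" where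
  "small_orlicz_space k \<Phi> w =
     {p. \<forall>\<rho>>0. orlicz_sum k \<Phi> w (\<lambda>m. cmod (p m) / \<rho>) < \<infinity>}"

text \<open>The real-valued norm; meaningful only on \<^const>\<open>orlicz_space\<close>, where the infimum is finite.\<close>

definition orlicz_norm ::
    "real \<Rightarrow> (real \<Rightarrow> real) \<Rightarrow> (int \<Rightarrow> real) \<Rightarrow> (int \<Rightarrow> complex) \<Rightarrow> real" where
  "orlicz_norm k \<Phi> w p = enn2real (orlicz_enorm k \<Phi> w p)"

text \<open>
  Complex normed spaces whose carrier is a set of two-sided sequences. Addition, subtraction and
  zero of sequences are the pointwise ones.
\<close>

definition seq_scale :: "complex \<Rightarrow> (int \<Rightarrow> complex) \<Rightarrow> (int \<Rightarrow> complex)" where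
  "seq_scale c p = (\<lambda>m. c * p m)"

definition normed_seq_space ::
    "(int \<Rightarrow> complex) set \<Rightarrow> ((int \<Rightarrow> complex) \<Rightarrow> real) \<Rightarrow> bool" where
  "normed_seq_space S N \<longleftrightarrow>
     module.subspace seq_scale S \<and>
     (\<forall>p\<in>S. 0 \<le> N p \<and> (N p = 0 \<longleftrightarrow> p = 0)) \<and>
     (\<forall>c. \<forall>p\<in>S. N (seq_scale c p) = cmod c * N p) \<and>
     (\<forall>p\<in>S. \<forall>q\<in>S. N (p + q) \<le> N p + N q)"

definition norm_dist ::
    "((int \<Rightarrow> complex) \<Rightarrow> real) \<Rightarrow> (int \<Rightarrow> complex) \<Rightarrow> (int \<Rightarrow> complex) \<Rightarrow> real" where
  "norm_dist N p q = N (p - q)"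

abbreviation norm_topology ::
    "(int \<Rightarrow> complex) set \<Rightarrow> ((int \<Rightarrow> complex) \<Rightarrow> real) \<Rightarrow> (int \<Rightarrow> complex) topology" where
  "norm_topology S N \<equiv> Metric_space.mtopology S (norm_dist N)"

definition banach_seq_space ::
    "(int \<Rightarrow> complex) set \<Rightarrow> ((int \<Rightarrow> complex) \<Rightarrow> real) \<Rightarrow> bool" where
  "banach_seq_space S N \<longleftrightarrow>
     normed_seq_space S N \<and> Metric_space.mcomplete S (norm_dist N)"

definition compact_linear_operator ::
    "(int \<Rightarrow> complex) set \<Rightarrow> ((int \<Rightarrow> complex) \<Rightarrow> real) \<Rightarrow>
     (int \<Rightarrow> complex) set \<Rightarrow> ((int \<Rightarrow> complex) \<Rightarrow> real) \<Rightarrow>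
     ((int \<Rightarrow> complex) \<Rightarrow> (int \<Rightarrow> complex)) \<Rightarrow> bool" where
  "compact_linear_operator S N T M f \<longleftrightarrow>
     normed_seq_space S N \<and> normed_seq_space T M \<and> f \<in> S \<rightarrow> T \<and>
     (\<forall>p\<in>S. \<forall>q\<in>S. f (p + q) = f p + f q) \<and>
     (\<forall>c. \<forall>p\<in>S. f (seq_scale c p) = seq_scale c (f p)) \<and>
     (\<forall>B\<subseteq>S. Metric_space.mbounded S (norm_dist N) B \<longrightarrow>
        compactin (norm_topology T M) (norm_topology T M closure_of (f ` B)))"

lemma module_seq_scale: "module seq_scale"
  by unfold_locales (simp_all add: seq_scale_def fun_eq_iff distrib_left distrib_right)

text \<open>
  The locale \<^locale>\<open>Metric_space\<close> asks for symmetry and nonnegativity of the distance also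
  outside the carrier; the distances used here satisfy this.
\<close>

lemma Metric_space_norm_dist_orlicz_norm:
  assumes "normed_seq_space S (orlicz_norm k \<Phi> w)"
  shows "Metric_space S (norm_dist (orlicz_norm k \<Phi> w))"
proof
  fix p q r :: "int \<Rightarrow> complex"
  let ?N = "orlicz_norm k \<Phi> w"
  have sub: "module.subspace seq_scale S"
    and zero: "\<forall>p\<in>S. 0 \<le> ?N p \<and> (?N p = 0 \<longleftrightarrow> p = 0)"
    and triangle: "\<forall>p\<in>S. \<forall>q\<in>S. ?N (p + q) \<le> ?N p + ?N q"
    using assms unfolding normed_seq_space_def by blast+
  have diff: "x - y \<in> S" if "x \<in> S" "y \<in> S" for x y
    by (rule module.subspace_diff[OF module_seq_scale sub that])
  show "0 \<le> norm_dist ?N p q"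
    by (simp add: norm_dist_def orlicz_norm_def)
  have "(\<lambda>m. cmod ((p - q) m)) = (\<lambda>m. cmod ((q - p) m))"
    unfolding fun_diff_def by (intro ext norm_minus_commute)
  then show "norm_dist ?N p q = norm_dist ?N q p"
    unfolding norm_dist_def orlicz_norm_def orlicz_enorm_def by (metis (no_types))
  show "norm_dist ?N p q = 0 \<longleftrightarrow> p = q" if "p \<in> S" "q \<in> S"
    using zero diff[OF that] right_minus_eq[of p q] unfolding norm_dist_def by blast
  show "norm_dist ?N p r \<le> norm_dist ?N p q + norm_dist ?N q r"
    if "p \<in> S" "q \<in> S" "r \<in> S"
  proof -
    have "?N ((p - q) + (q - r)) \<le> ?N (p - q) + ?N (q - r)"
      using triangle diff that by blast
    moreover have "(p - q) + (q - r) = p - r"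
      by simp
    ultimately show ?thesis
      unfolding norm_dist_def by (simp only:)
  qed
qed

end

theory Submission
  imports Defs "HOL-Complex_Analysis.Great_Picard"
begin

text \<open>
  Since the weights are bounded below, a finite modular forces all but finitely many entries to be
  small, so the doubling condition near \<open>0\<close> suffices to make the finiteness of the modular
  independent of rescaling. Truncation and rational approximation of the remaining finitely many
  entries give separability, and lower semicontinuity of the modular under coordinatewise
  convergence gives completeness. For compactness, the quotient of the weights for \<open>k\<close> and \<open>k'\<close>
  tends to \<open>0\<close> because \<open>\<Phi>\<close> is unbounded; hence on a bounded set the \<open>k\<close>-modular has uniformly
  small tails at every scale, and a coordinatewise convergent subsequence is Cauchy.
\<close>

subsection \<open>Orlicz functions with the doubling condition at zero\<close>

locale orlicz_delta2 =
  fixes \<Phi> :: "real \<Rightarrow> real"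
  assumes orlicz: "orlicz_function \<Phi>"
    and delta2: "Limsup (at_right 0) (\<lambda>t. ereal (\<Phi> (2 * t) / \<Phi> t)) < \<infinity>"
begin

lemma Phi_nonneg: "0 \<le> t \<Longrightarrow> 0 \<le> \<Phi> t"
  and Phi_0: "\<Phi> 0 = 0"
  and Phi_pos: "0 < t \<Longrightarrow> 0 < \<Phi> t"
  and Phi_mono: "0 \<le> s \<Longrightarrow> s \<le> t \<Longrightarrow> \<Phi> s \<le> \<Phi> t"
  and Phi_convex: "convex_on {0..} \<Phi>"
  and Phi_continuous: "continuous_on {0..} \<Phi>"
  and Phi_at_top: "filterlim \<Phi> at_top at_top"
  using orlicz by (auto simp: orlicz_function_def Pi_iff mono_on_def)

lemma Phi_convex_comb:
  assumes "0 \<le> x" "0 \<le> y" "0 \<le> u" "0 \<le> v" "u + v = 1"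
  shows "\<Phi> (u * x + v * y) \<le> u * \<Phi> x + v * \<Phi> y"
  using Phi_convex assms by (auto simp: convex_on_def)

lemma Phi_scale_le:
  assumes "0 \<le> t" "0 \<le> u" "u \<le> 1"
  shows "\<Phi> (u * t) \<le> u * \<Phi> t"
  using Phi_convex_comb[of t 0 u "1 - u"] assms by (simp add: Phi_0)

lemma Phi_tendsto:
  assumes "(f \<longlongrightarrow> l) F" "0 \<le> l" "\<And>x. 0 \<le> f x"
  shows "((\<lambda>x. \<Phi> (f x)) \<longlongrightarrow> \<Phi> l) F"
  using continuous_on_tendsto_compose[OF Phi_continuous assms(1)] assms(2,3) by simp

text \<open>Sublevel sets of \<Phi> are bounded because \<Phi> tends to infinity. This later
  converts a bound on one summand of the modular into a bound on the coordinate itself.\<close>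

lemma Phi_le_imp_bounded: "\<exists>c>0. \<forall>t\<ge>0. \<Phi> t \<le> b \<longrightarrow> t \<le> c"
proof -
  obtain c where c: "\<And>t. t \<ge> c \<Longrightarrow> b + 1 \<le> \<Phi> t"
    using Phi_at_top unfolding filterlim_at_top eventually_at_top_linorder by metis
  have "t \<le> max c 1" if "\<Phi> t \<le> b" for t
    using c[of t] that by linarith
  then show ?thesis by (intro exI[of _ "max c 1"]) auto
qed

text \<open>Doubling is iterated \<open>n\<close> times with \<open>l\<close> at most
  \<open>2 ^ n\<close>, and monotonicity passes from \<open>2 ^ n\<close> back to \<open>l\<close>.
  The constants multiply, while the interval of validity shrinks with \<open>n\<close>.\<close>

lemma delta2_scaled:
  "\<exists>C>0. \<exists>t0>0. \<forall>t. 0 \<le> t \<and> t \<le> t0 \<longrightarrow> \<Phi> (l * t) \<le> C * \<Phi> t" if "0 \<le> l" for l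
proof -
  have two: "\<exists>C>0. \<exists>t0>0. \<forall>t. 0 \<le> t \<and> t \<le> t0 \<longrightarrow> \<Phi> (2 * t) \<le> C * \<Phi> t"
  proof -
    obtain C where C: "Limsup (at_right 0) (\<lambda>t. ereal (\<Phi> (2 * t) / \<Phi> t)) < ereal C"
      using ereal_dense2[OF delta2] by blast
    then obtain b where b: "b > 0" "\<And>t. 0 < t \<Longrightarrow> t < b \<Longrightarrow> \<Phi> (2 * t) / \<Phi> t < C"
      using Limsup_lessD[OF C] unfolding eventually_at_right_field by auto
    \<comment> \<open>The choice \<open>C\<close> only exceeds the limsup; \<open>max C 1\<close> is
      positive as well. Halving \<open>b\<close> turns the open interval into a closed one.\<close>
    have "\<Phi> (2 * t) \<le> max C 1 * \<Phi> t" if "0 \<le> t" "t \<le> b / 2" for t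
    proof (cases "t = 0")
      case False
      then have "\<Phi> (2 * t) \<le> C * \<Phi> t"
        using b(2)[of t] b(1) that Phi_pos[of t] by (simp add: field_simps)
      also have "\<dots> \<le> max C 1 * \<Phi> t"
        using that by (intro mult_right_mono Phi_nonneg) auto
      finally show ?thesis .
    qed (simp add: Phi_0)
    then show ?thesis
      using b(1) by (intro exI[of _ "max C 1"] conjI exI[of _ "b/2"]) auto
  qed
  have pow: "\<exists>C>0. \<exists>t0>0. \<forall>t. 0 \<le> t \<and> t \<le> t0 \<longrightarrow> \<Phi> (2 ^ n * t) \<le> C * \<Phi> t" for n
  proof (induction n)
    case 0
    show ?case by (intro exI[of _ 1] conjI) auto
  next
    case (Suc n)
    then obtain C t0 where C: "C > 0" "t0 > 0"
      "\<And>t. 0 \<le> t \<Longrightarrow> t \<le> t0 \<Longrightarrow> \<Phi> (2 ^ n * t) \<le> C * \<Phi> t" by auto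
    obtain D s0 where D: "D > 0" "s0 > 0"
      "\<And>t. 0 \<le> t \<Longrightarrow> t \<le> s0 \<Longrightarrow> \<Phi> (2 * t) \<le> D * \<Phi> t" using two by auto
    \<comment> \<open>The bound \<open>s0 / 2 ^ n\<close> keeps \<open>2 ^ n * t\<close> in the
      range where a further doubling is allowed.\<close>
    have "\<Phi> (2 ^ Suc n * t) \<le> (D * C) * \<Phi> t" if t: "0 \<le> t" "t \<le> min t0 (s0 / 2 ^ n)" for t
    proof -
      have "\<Phi> (2 * (2 ^ n * t)) \<le> D * \<Phi> (2 ^ n * t)"
        using t by (intro D(3)) (auto simp: field_simps)
      also have "\<dots> \<le> D * (C * \<Phi> t)"
        using t D(1) by (intro mult_left_mono C(3)) auto
      finally show ?thesis by (simp add: mult_ac)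
    qed
    then show ?case
      using C(1,2) D(1,2) by (intro exI[of _ "D * C"] conjI exI[of _ "min t0 (s0 / 2 ^ n)"]) auto
  qed
  obtain n where n: "l \<le> 2 ^ n"
    using real_arch_pow[of 2 l] by (auto intro: less_imp_le)
  obtain C t0 where C: "C > 0" "t0 > 0"
      "\<And>t. 0 \<le> t \<Longrightarrow> t \<le> t0 \<Longrightarrow> \<Phi> (2 ^ n * t) \<le> C * \<Phi> t" using pow by metis
  have "\<Phi> (l * t) \<le> C * \<Phi> t" if "0 \<le> t" "t \<le> t0" for t
  proof -
    have "\<Phi> (l * t) \<le> \<Phi> (2 ^ n * t)"
      using that n \<open>0 \<le> l\<close> by (intro Phi_mono mult_right_mono) auto
    then show ?thesis using C(3)[OF that] by linarith
  qed
  then show ?thesis using C(1,2) by blast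
qed

end

subsection \<open>Modulars with weights bounded below\<close>

text \<open>The lower bound is put on the full weight, power included, since this is the form the
  estimates use. One \<open>\<delta>\<close> can then serve two exponents at once, as the
  compactness proof requires.\<close>

locale orlicz_weight = orlicz_delta2 +
  fixes k :: real and w :: "int \<Rightarrow> real" and \<delta> :: real
  assumes delta_pos: "0 < \<delta>"
    and weight_ge: "\<And>m. \<delta> \<le> w m * (1 + \<Phi> (real_of_int \<bar>m\<bar>)) powr k"
begin

definition wt :: "int \<Rightarrow> real" where
  "wt m = w m * (1 + \<Phi> (real_of_int \<bar>m\<bar>)) powr k"

text \<open>
  An upper bound for the modular in terms of finite partial sums, which keeps all estimates
  in \<^typ>\<open>real\<close>.
\<close>

definition modular_le :: "(int \<Rightarrow> real) \<Rightarrow> real \<Rightarrow> bool" where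
  "modular_le a c \<longleftrightarrow> (\<forall>F. finite F \<longrightarrow> (\<Sum>m\<in>F. wt m * \<Phi> (a m)) \<le> c)"

abbreviation (input) N :: "(int \<Rightarrow> complex) \<Rightarrow> real" where
  "N \<equiv> orlicz_norm k \<Phi> w"

abbreviation (input) S :: "(int \<Rightarrow> complex) set" where
  "S \<equiv> orlicz_space k \<Phi> w"

lemma wt_ge: "\<delta> \<le> wt m"
  using weight_ge by (simp add: wt_def)

lemma wt_pos: "0 < wt m"
  using wt_ge[of m] delta_pos by linarith

lemma summand_nonneg: "0 \<le> t \<Longrightarrow> 0 \<le> wt m * \<Phi> t"
  using wt_pos[of m] Phi_nonneg by simp

lemma modular_leD: "modular_le a c \<Longrightarrow> finite F \<Longrightarrow> (\<Sum>m\<in>F. wt m * \<Phi> (a m)) \<le> c"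
  by (simp add: modular_le_def)

lemma modular_le_single: "modular_le a c \<Longrightarrow> wt m * \<Phi> (a m) \<le> c"
  using modular_leD[of a c "{m}"] by simp

text \<open>A sum of nonnegative extended reals is the supremum of its finite partial sums. This
  lemma and the next carry the extended-valued definitions over to real estimates.\<close>

lemma orlicz_sum_le_iff:
  assumes "\<And>m. 0 \<le> a m" "0 \<le> c"
  shows "orlicz_sum k \<Phi> w a \<le> ennreal c \<longleftrightarrow> modular_le a c"
proof -
  have "orlicz_sum k \<Phi> w a = (SUP F\<in>{F. finite F}. \<Sum>m\<in>F. ennreal (wt m * \<Phi> (a m)))"
    unfolding orlicz_sum_def wt_def by (subst nonneg_infsum_complete) auto
  also have "\<dots> = (SUP F\<in>{F. finite F}. ennreal (\<Sum>m\<in>F. wt m * \<Phi> (a m)))"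
    by (intro SUP_cong refl sum_ennreal summand_nonneg assms)
  finally show ?thesis
    using assms(2) by (simp add: SUP_le_iff modular_le_def)
qed

lemma orlicz_sum_finite_iff:
  assumes "\<And>m. 0 \<le> a m"
  shows "orlicz_sum k \<Phi> w a < \<infinity> \<longleftrightarrow> (\<exists>c. modular_le a c)"
proof
  assume "orlicz_sum k \<Phi> w a < \<infinity>"
  then obtain c where "0 \<le> c" "orlicz_sum k \<Phi> w a = ennreal c"
    by (metis ennreal_cases infinity_ennreal_def less_irrefl)
  then show "\<exists>c. modular_le a c"
    using orlicz_sum_le_iff[of a c] assms by auto
next
  assume "\<exists>c. modular_le a c"
  then obtain c where c: "modular_le a c" by blast
  then have "0 \<le> c" using modular_leD[OF c, of "{}"] by simp
  then have "orlicz_sum k \<Phi> w a \<le> ennreal c"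
    using orlicz_sum_le_iff[of a c] assms c by auto
  then show "orlicz_sum k \<Phi> w a < \<infinity>"
    unfolding infinity_ennreal_def by (rule le_less_trans[OF _ ennreal_less_top])
qed

section \<open>Monotonicity, convexity and rescaling of modular bounds\<close>

lemma modular_le_mono:
  assumes "modular_le b c" "\<And>m. 0 \<le> a m" "\<And>m. a m \<le> b m"
  shows "modular_le a c"
  unfolding modular_le_def
proof (intro allI impI)
  fix F :: "int set" assume "finite F"
  have "(\<Sum>m\<in>F. wt m * \<Phi> (a m)) \<le> (\<Sum>m\<in>F. wt m * \<Phi> (b m))"
    using wt_pos assms by (intro sum_mono mult_left_mono Phi_mono) (auto simp: less_imp_le)
  also have "\<dots> \<le> c"
    using modular_leD[OF assms(1) \<open>finite F\<close>] .
  finally show "(\<Sum>m\<in>F. wt m * \<Phi> (a m)) \<le> c" .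
qed

text \<open>Convexity of \<Phi> is applied summand by summand. The triangle inequality rests on
  this, and so does shrinking, where the second sequence is zero.\<close>

lemma modular_le_convex_comb:
  assumes "modular_le a c" "modular_le b d" "\<And>m. 0 \<le> a m" "\<And>m. 0 \<le> b m"
    and uv: "0 \<le> u" "0 \<le> v" "u + v = 1"
  shows "modular_le (\<lambda>m. u * a m + v * b m) (u * c + v * d)"
  unfolding modular_le_def
proof (intro allI impI)
  fix F :: "int set" assume F: "finite F"
  have "(\<Sum>m\<in>F. wt m * \<Phi> (u * a m + v * b m)) \<le> (\<Sum>m\<in>F. wt m * (u * \<Phi> (a m) + v * \<Phi> (b m)))"
    using wt_pos assms by (intro sum_mono mult_left_mono Phi_convex_comb) (auto simp: less_imp_le)
  also have "\<dots> = u * (\<Sum>m\<in>F. wt m * \<Phi> (a m)) + v * (\<Sum>m\<in>F. wt m * \<Phi> (b m))"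
    by (simp add: sum_distrib_left sum.distrib[symmetric] algebra_simps)
  also have "\<dots> \<le> u * c + v * d"
    using uv modular_leD[OF assms(1) F] modular_leD[OF assms(2) F]
    by (intro add_mono mult_left_mono)
  finally show "(\<Sum>m\<in>F. wt m * \<Phi> (u * a m + v * b m)) \<le> u * c + v * d" .
qed

lemma modular_le_zero: "0 \<le> c \<Longrightarrow> modular_le (\<lambda>m. 0) c"
  by (simp add: modular_le_def Phi_0)

lemma modular_le_shrink:
  assumes "modular_le a c" "\<And>m. 0 \<le> a m" "0 \<le> u" "u \<le> 1"
  shows "modular_le (\<lambda>m. u * a m) (u * c)"
  using modular_le_convex_comb[OF assms(1) modular_le_zero[of 0], of u "1 - u"] assms(2-) by simp

text \<open>Each index with entry at least \<open>t\<close> contributes at least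
  \<open>\<delta> * \<Phi> t\<close>, so there are at most \<open>c / (\<delta> * \<Phi> t)\<close>
  of them.\<close>

lemma modular_le_finite_large:
  assumes "modular_le a c" "\<And>m. 0 \<le> a m" "0 < t"
  shows "finite {m. t \<le> a m}"
proof -
  have t: "0 < \<delta> * \<Phi> t"
    using delta_pos Phi_pos[OF \<open>0 < t\<close>] by simp
  have "card G \<le> nat \<lfloor>c / (\<delta> * \<Phi> t)\<rfloor>" if G: "G \<subseteq> {m. t \<le> a m}" "finite G" for G
  proof -
    have "of_nat (card G) * (\<delta> * \<Phi> t) = (\<Sum>m\<in>G. \<delta> * \<Phi> t)"
      by simp
    also have "\<dots> \<le> (\<Sum>m\<in>G. wt m * \<Phi> (a m))"
      using G assms(3) wt_ge delta_pos wt_pos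
      by (intro sum_mono mult_mono Phi_mono Phi_nonneg) (auto simp: less_imp_le)
    also have "\<dots> \<le> c"
      using modular_leD[OF assms(1) G(2)] .
    finally have "of_nat (card G) \<le> c / (\<delta> * \<Phi> t)"
      using t by (simp add: pos_le_divide_eq)
    then show ?thesis by linarith
  qed
  then show ?thesis
    using finite_if_finite_subsets_card_bdd by blast
qed

text \<open>Only finitely many entries reach the threshold \<open>t0\<close>, and they contribute a
  fixed finite sum. All the others lie where \<Phi> grows by at most the factor \<open>C\<close>
  under scaling by \<open>l\<close>.\<close>

lemma modular_le_scale:
  assumes "modular_le a c" "\<And>m. 0 \<le> a m" "0 \<le> l"
  shows "\<exists>c'. modular_le (\<lambda>m. l * a m) c'"
proof -
  obtain C t0 where C: "C > 0" "t0 > 0"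
    "\<And>t. 0 \<le> t \<Longrightarrow> t \<le> t0 \<Longrightarrow> \<Phi> (l * t) \<le> C * \<Phi> t" using delta2_scaled[OF assms(3)] by auto
  define E where "E = {m. t0 \<le> a m}"
  have E: "finite E"
    unfolding E_def by (rule modular_le_finite_large[OF assms(1,2) C(2)])
  have "modular_le (\<lambda>m. l * a m) ((\<Sum>m\<in>E. wt m * \<Phi> (l * a m)) + C * c)"
    unfolding modular_le_def
  proof (intro allI impI)
    fix F :: "int set" assume F: "finite F"
    have "(\<Sum>m\<in>F. wt m * \<Phi> (l * a m)) =
        (\<Sum>m\<in>F \<inter> E. wt m * \<Phi> (l * a m)) + (\<Sum>m\<in>F - E. wt m * \<Phi> (l * a m))"
      using F by (rule sum.Int_Diff)
    also have "(\<Sum>m\<in>F \<inter> E. wt m * \<Phi> (l * a m)) \<le> (\<Sum>m\<in>E. wt m * \<Phi> (l * a m))"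
      using E assms by (intro sum_mono2 summand_nonneg) auto
    also have "(\<Sum>m\<in>F - E. wt m * \<Phi> (l * a m)) \<le> (\<Sum>m\<in>F - E. C * (wt m * \<Phi> (a m)))"
    proof (rule sum_mono)
      fix m assume "m \<in> F - E"
      then have "\<Phi> (l * a m) \<le> C * \<Phi> (a m)"
        using assms(2) by (intro C(3)) (auto simp: E_def)
      then show "wt m * \<Phi> (l * a m) \<le> C * (wt m * \<Phi> (a m))"
        using mult_left_mono[OF _ less_imp_le[OF wt_pos[of m]]] by (fastforce simp: mult_ac)
    qed
    also have "\<dots> \<le> C * c"
      using modular_leD[OF assms(1), of "F - E"] F C(1)
      by (simp add: sum_distrib_left[symmetric])
    finally show "(\<Sum>m\<in>F. wt m * \<Phi> (l * a m)) \<le> (\<Sum>m\<in>E. wt m * \<Phi> (l * a m)) + C * c"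
      by simp
  qed
  then show ?thesis by blast
qed

text \<open>Choose \<open>F\<close> with partial sum within \<open>e\<close> of the supremum
  \<open>s\<close>. A disjoint \<open>G\<close> contributing more than \<open>e\<close> would push
  the sum over the union beyond \<open>s\<close>.\<close>

lemma modular_le_tail:
  assumes "modular_le a c" "0 < e"
  shows "\<exists>F. finite F \<and> (\<forall>G. finite G \<and> G \<inter> F = {} \<longrightarrow> (\<Sum>m\<in>G. wt m * \<Phi> (a m)) \<le> e)"
proof -
  let ?f = "\<lambda>F. \<Sum>m\<in>F. wt m * \<Phi> (a m)"
  define s where "s = (SUP F\<in>{F. finite F}. ?f F)"
  have bdd: "bdd_above (?f ` {F. finite F})"
    using modular_leD[OF assms(1)] by (auto intro!: bdd_aboveI[of _ c])
  have "s - e < Sup (?f ` {F. finite F})" using assms(2) by (simp add: s_def)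
  then have "\<exists>x\<in>?f ` {F. finite F}. s - e < x"
    by (rule less_cSupD[rotated]) auto
  then obtain F where F: "finite F" "s - e < ?f F" by blast
  have "?f G \<le> e" if G: "finite G" "G \<inter> F = {}" for G
  proof -
    have "?f (G \<union> F) \<le> s"
      unfolding s_def using F G by (intro cSUP_upper bdd) auto
    moreover have "?f (G \<union> F) = ?f G + ?f F"
      using F G by (intro sum.union_disjoint) auto
    ultimately show ?thesis using F(2) by linarith
  qed
  then show ?thesis using F(1) by blast
qed

subsection \<open>The Luxemburg norm\<close>

lemma enorm_le:
  assumes "0 < r" "modular_le (\<lambda>m. cmod (p m) / r) 1"
  shows "orlicz_enorm k \<Phi> w p \<le> ennreal r"
  unfolding orlicz_enorm_def
  using orlicz_sum_le_iff[of "\<lambda>m. cmod (p m) / r" 1] assms by (intro Inf_lower) auto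

lemma in_orlicz_space:
  assumes "0 < r" "modular_le (\<lambda>m. cmod (p m) / r) 1"
  shows "p \<in> S"
  using le_less_trans[OF enorm_le[OF assms]] by (simp add: orlicz_space_def)

lemma norm_le:
  assumes "0 < r" "modular_le (\<lambda>m. cmod (p m) / r) 1"
  shows "N p \<le> r"
  using enorm_le[OF assms] assms(1) unfolding orlicz_norm_def by (intro enn2real_leI) auto

text \<open>An admissible \<open>q\<close> lies strictly below \<open>r\<close>, and enlarging the
  divisor decreases the modular. The strict inequality avoids the question whether the infimum is
  attained; later proofs let \<open>r\<close> decrease to the norm by
  \<open>dense_ge\<close>.\<close>

lemma modular_le_of_norm_less:
  assumes "p \<in> S" "N p < r"
  shows "modular_le (\<lambda>m. cmod (p m) / r) 1"
proof -
  have "orlicz_enorm k \<Phi> w p = ennreal (N p)"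
    using assms(1) by (simp add: orlicz_space_def orlicz_norm_def)
  also have "\<dots> < ennreal r"
    using assms(2) by (intro ennreal_lessI) (auto simp: orlicz_norm_def intro: le_less_trans[OF enn2real_nonneg])
  finally obtain q where q: "0 < q" "orlicz_sum k \<Phi> w (\<lambda>m. cmod (p m) / q) \<le> 1" "ennreal q < ennreal r"
    unfolding orlicz_enorm_def Inf_less_iff by blast
  have "modular_le (\<lambda>m. cmod (p m) / q) 1"
    using q(1,2) orlicz_sum_le_iff[of "\<lambda>m. cmod (p m) / q" 1] by auto
  moreover have "q \<le> r" using q(1,3) by (simp add: ennreal_less_iff)
  ultimately show ?thesis
    using q(1) by (elim modular_le_mono) (auto intro!: divide_left_mono)
qed

section \<open>Coincidence of the three spaces\<close>

lemma orlicz_class_iff: "p \<in> orlicz_class k \<Phi> w \<longleftrightarrow> (\<exists>c. modular_le (\<lambda>m. cmod (p m)) c)"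
  unfolding orlicz_class_def using orlicz_sum_finite_iff[of "\<lambda>m. cmod (p m)"] by simp

lemma small_eq_class: "small_orlicz_space k \<Phi> w = orlicz_class k \<Phi> w"
proof (intro set_eqI iffI)
  fix p assume "p \<in> small_orlicz_space k \<Phi> w"
  then show "p \<in> orlicz_class k \<Phi> w"
    by (auto simp: small_orlicz_space_def orlicz_class_def dest: spec[of _ 1])
next
  fix p assume "p \<in> orlicz_class k \<Phi> w"
  then obtain c where c: "modular_le (\<lambda>m. cmod (p m)) c" by (auto simp: orlicz_class_iff)
  \<comment> \<open>This is where doubling enters: for small \<open>\<rho>\<close> the sequence is
    enlarged, which convexity alone does not control.\<close>
  have "orlicz_sum k \<Phi> w (\<lambda>m. cmod (p m) / \<rho>) < \<infinity>" if "0 < \<rho>" for \<rho>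
    using modular_le_scale[OF c, of "1 / \<rho>"] that orlicz_sum_finite_iff[of "\<lambda>m. cmod (p m) / \<rho>"] by simp
  then show "p \<in> small_orlicz_space k \<Phi> w"
    by (simp add: small_orlicz_space_def)
qed

lemma class_eq_space: "orlicz_class k \<Phi> w = S"
proof (intro set_eqI iffI)
  fix p assume "p \<in> orlicz_class k \<Phi> w"
  then obtain c where c: "modular_le (\<lambda>m. cmod (p m)) c" by (auto simp: orlicz_class_iff)
  \<comment> \<open>Dividing by \<open>r\<close>, which is at least 1, shrinks the modular at least
    by the factor \<open>1 / r\<close>; having \<open>c\<close> at most \<open>r\<close> then brings
    it down to 1.\<close>
  define r where "r = max c 1"
  have r: "1 \<le> r" "c \<le> r" by (auto simp: r_def)
  have "modular_le (\<lambda>m. 1 / r * cmod (p m)) (1 / r * c)"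
    using r by (intro modular_le_shrink c) auto
  moreover have "1 / r * c \<le> 1" using r by simp
  ultimately have "modular_le (\<lambda>m. cmod (p m) / r) 1"
    unfolding modular_le_def by (force intro: order_trans)
  then show "p \<in> S" using r by (intro in_orlicz_space[of r]) auto
next
  fix p assume p: "p \<in> S"
  \<comment> \<open>Any number strictly above the norm is admissible; the division by it is then
    undone by \<open>modular_le_scale\<close>.\<close>
  define r where "r = N p + 1"
  have "0 \<le> N p" by (simp add: orlicz_norm_def)
  then have r: "0 < r" by (simp add: r_def)
  have "modular_le (\<lambda>m. cmod (p m) / r) 1"
    using p by (rule modular_le_of_norm_less) (simp add: r_def)
  from modular_le_scale[OF this, of r] r show "p \<in> orlicz_class k \<Phi> w"
    by (simp add: orlicz_class_iff)
qed

section \<open>Coordinate bound, vector space structure and norm axioms\<close>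

lemma norm_nonneg: "0 \<le> N p"
  by (simp add: orlicz_norm_def)

text \<open>After division by \<open>r\<close> above the norm, every single summand is at most 1, so
  \<Phi> of the scaled coordinate is at most \<open>1 / \<delta>\<close>. The constant bounds that
  sublevel set and is uniform in \<open>p\<close> and \<open>m\<close>; definiteness, completeness
  and compactness all use it.\<close>

lemma coordinate_bound: "\<exists>c>0. \<forall>p\<in>S. \<forall>m. cmod (p m) \<le> c * N p"
proof -
  obtain c where c: "0 < c" "\<And>t. 0 \<le> t \<Longrightarrow> \<Phi> t \<le> 1 / \<delta> \<Longrightarrow> t \<le> c"
    using Phi_le_imp_bounded by meson
  have "cmod (p m) \<le> c * N p" if p: "p \<in> S" for p m
  proof -
    have "cmod (p m) / c \<le> r" if r: "N p < r" for r
    proof -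
      have "0 < r" using norm_nonneg[of p] r by linarith
      have "\<delta> * \<Phi> (cmod (p m) / r) \<le> wt m * \<Phi> (cmod (p m) / r)"
        using \<open>0 < r\<close> by (intro mult_right_mono wt_ge Phi_nonneg) auto
      also have "\<dots> \<le> 1"
        using modular_le_single[OF modular_le_of_norm_less[OF p r]] .
      finally have "cmod (p m) / r \<le> c"
        using \<open>0 < r\<close> delta_pos by (intro c(2)) (auto simp: field_simps)
      then show ?thesis using \<open>0 < r\<close> c(1) by (simp add: field_simps)
    qed
    then have "cmod (p m) / c \<le> N p" by (rule dense_ge)
    then show ?thesis using c(1) by (simp add: field_simps)
  qed
  then show ?thesis using c(1) by blast
qed

text \<open>The scaled sum is dominated by the convex combination of \<open>p / a\<close> and
  \<open>q / b\<close> with coefficients \<open>a / (a + b)\<close> and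
  \<open>b / (a + b)\<close>.\<close>

lemma modular_le_add:
  assumes p: "p \<in> S" and q: "q \<in> S" and a: "N p < a" and b: "N q < b"
  shows "modular_le (\<lambda>m. cmod ((p + q) m) / (a + b)) 1"
proof -
  have ab: "0 < a" "0 < b" using norm_nonneg[of p] norm_nonneg[of q] a b by linarith+
  have "modular_le (\<lambda>m. a / (a + b) * (cmod (p m) / a) + b / (a + b) * (cmod (q m) / b))
      (a / (a + b) * 1 + b / (a + b) * 1)"
    using ab modular_le_of_norm_less[OF p a] modular_le_of_norm_less[OF q b]
    by (intro modular_le_convex_comb) (auto simp: add_divide_distrib[symmetric])
  also have "a / (a + b) * 1 + b / (a + b) * 1 = 1"
    using ab by (simp add: add_divide_distrib[symmetric])
  finally show ?thesis
  proof (rule modular_le_mono)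
    fix m
    show "cmod ((p + q) m) / (a + b) \<le> a / (a + b) * (cmod (p m) / a) + b / (a + b) * (cmod (q m) / b)"
      using ab norm_triangle_ineq[of "p m" "q m"]
      by (simp add: add_divide_distrib[symmetric] divide_right_mono)
  qed (use ab in auto)
qed

lemma add_mem: "p \<in> S \<Longrightarrow> q \<in> S \<Longrightarrow> p + q \<in> S"
  using modular_le_add[of p q "N p + 1" "N q + 1"] norm_nonneg[of p] norm_nonneg[of q]
  by (intro in_orlicz_space[of "(N p + 1) + (N q + 1)"]) auto

lemma norm_triangle:
  assumes "p \<in> S" "q \<in> S"
  shows "N (p + q) \<le> N p + N q"
proof (rule field_le_epsilon)
  fix e :: real assume "0 < e"
  then show "N (p + q) \<le> N p + N q + e"
    using modular_le_add[OF assms, of "N p + e / 2" "N q + e / 2"] norm_nonneg[of p] norm_nonneg[of q]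
      norm_le[of "(N p + e / 2) + (N q + e / 2)" "p + q"] by simp
qed

lemma modular_le_seq_scale:
  assumes "p \<in> S" "N p < r" "c \<noteq> 0"
  shows "modular_le (\<lambda>m. cmod (seq_scale c p m) / (cmod c * r)) 1"
proof -
  have "(\<lambda>m. cmod (seq_scale c p m) / (cmod c * r)) = (\<lambda>m. cmod (p m) / r)"
    using assms(3) by (simp add: seq_scale_def norm_mult)
  then show ?thesis
    using modular_le_of_norm_less[OF assms(1,2)] by metis
qed

lemma zero_modular: "modular_le (\<lambda>m. cmod ((0 :: int \<Rightarrow> complex) m) / r) 1"
  using modular_le_zero[of 1] by simp

lemma zero_mem: "0 \<in> S"
  by (rule in_orlicz_space[OF zero_less_one zero_modular])

lemma norm_zero: "N 0 = 0"
proof -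
  have "N 0 \<le> 0"
    by (rule dense_ge) (rule norm_le[OF _ zero_modular])
  then show ?thesis using norm_nonneg[of 0] by linarith
qed

lemma scale_mem:
  assumes "p \<in> S"
  shows "seq_scale c p \<in> S"
proof (cases "c = 0")
  case True
  then have "seq_scale c p = 0" by (simp add: seq_scale_def fun_eq_iff)
  then show ?thesis by (simp add: zero_mem)
next
  case False
  have "N p < N p + 1" by simp
  show ?thesis
  proof (rule in_orlicz_space)
    show "modular_le (\<lambda>m. cmod (seq_scale c p m) / (cmod c * (N p + 1))) 1"
      by (rule modular_le_seq_scale[OF assms \<open>N p < N p + 1\<close> False])
    show "0 < cmod c * (N p + 1)"
      using False norm_nonneg[of p] by (intro mult_pos_pos) auto
  qed
qed

lemma norm_scale_le:
  assumes "p \<in> S" "c \<noteq> 0"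
  shows "N (seq_scale c p) \<le> cmod c * N p"
proof -
  have "N (seq_scale c p) / cmod c \<le> r" if "N p < r" for r
  proof -
    have "0 < r" using norm_nonneg[of p] that by linarith
    then have "N (seq_scale c p) \<le> cmod c * r"
      using modular_le_seq_scale[OF assms(1) that assms(2)] assms(2) by (intro norm_le) auto
    then show ?thesis using assms(2) by (simp add: field_simps)
  qed
  then have "N (seq_scale c p) / cmod c \<le> N p" by (rule dense_ge)
  then show ?thesis using assms(2) by (simp add: field_simps)
qed

lemma norm_scale:
  assumes "p \<in> S"
  shows "N (seq_scale c p) = cmod c * N p"
proof (cases "c = 0")
  case True
  then have "seq_scale c p = 0" by (simp add: seq_scale_def fun_eq_iff)
  then show ?thesis using True by (simp add: norm_zero)
next
  case False
  \<comment> \<open>The reverse inequality is \<open>norm_scale_le\<close> for the inverse scalar,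
    applied to the scaled sequence.\<close>
  have "seq_scale (inverse c) (seq_scale c p) = p"
    using False by (simp add: seq_scale_def fun_eq_iff)
  then have "N p \<le> cmod (inverse c) * N (seq_scale c p)"
    using norm_scale_le[OF scale_mem[OF assms, of c], of "inverse c"] False by simp
  then have "cmod c * N p \<le> cmod c * (cmod (inverse c) * N (seq_scale c p))"
    by (intro mult_left_mono) auto
  also have "\<dots> = N (seq_scale c p)"
    using False by (simp add: norm_inverse)
  finally have "cmod c * N p \<le> N (seq_scale c p)" .
  then show ?thesis using norm_scale_le[OF assms False] by linarith
qed

lemma normed_space: "normed_seq_space S N"
  unfolding normed_seq_space_def
proof (intro conjI ballI allI)
  show "module.subspace seq_scale S"
    unfolding module.subspace_def[OF module_seq_scale] using zero_mem add_mem scale_mem by blast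
  fix p assume p: "p \<in> S"
  show "0 \<le> N p" by (rule norm_nonneg)
  show "N p = 0 \<longleftrightarrow> p = 0"
  proof
    assume "N p = 0"
    then have "cmod (p m) \<le> 0" for m
      using coordinate_bound p by (metis mult_zero_right)
    then show "p = 0" by (simp add: fun_eq_iff)
  qed (simp add: norm_zero)
  show "N (seq_scale c p) = cmod c * N p" for c by (rule norm_scale[OF p])
  show "N (p + q) \<le> N p + N q" if "q \<in> S" for q by (rule norm_triangle[OF p that])
qed

sublocale Metric_space "orlicz_space k \<Phi> w" "norm_dist (orlicz_norm k \<Phi> w)"
  by (rule Metric_space_norm_dist_orlicz_norm[OF normed_space])

lemma diff_mem: "p \<in> S \<Longrightarrow> q \<in> S \<Longrightarrow> p - q \<in> S"
  by (rule module.subspace_diff[OF module_seq_scale conjunct1[OF normed_space[unfolded normed_seq_space_def]]])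

subsection \<open>Completeness and separability\<close>

text \<open>A finite partial sum depends continuously on finitely many coordinates, so its bound
  passes to the limit. Bounding partial sums one at a time avoids interchanging a limit with an
  infinite sum.\<close>

lemma modular_le_lim:
  assumes "\<And>m. (\<lambda>i. a i m) \<longlonglongrightarrow> b m" "\<And>i m. 0 \<le> a i m" "\<forall>\<^sub>F i in sequentially. modular_le (a i) c"
  shows "modular_le b c"
  unfolding modular_le_def
proof (intro allI impI)
  fix F :: "int set" assume F: "finite F"
  have "0 \<le> b m" for m
    by (rule LIMSEQ_le_const[OF assms(1)]) (simp add: assms(2))
  then have "(\<lambda>i. \<Sum>m\<in>F. wt m * \<Phi> (a i m)) \<longlonglongrightarrow> (\<Sum>m\<in>F. wt m * \<Phi> (b m))"
    by (intro tendsto_sum tendsto_mult tendsto_const Phi_tendsto assms(1,2))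
  moreover have "\<forall>\<^sub>F i in sequentially. (\<Sum>m\<in>F. wt m * \<Phi> (a i m)) \<le> c"
    using assms(3) by (rule eventually_mono) (rule modular_leD[OF _ F])
  ultimately show "(\<Sum>m\<in>F. wt m * \<Phi> (b m)) \<le> c"
    by (intro tendsto_upperbound) auto
qed

lemma complete: mcomplete
  unfolding mcomplete_def
proof (intro allI impI)
  fix \<sigma> assume \<sigma>: "MCauchy \<sigma>"
  then have mem: "\<sigma> n \<in> S" for n by (auto simp: MCauchy_def)
  have cau: "\<exists>M. \<forall>n\<ge>M. \<forall>n'\<ge>M. N (\<sigma> n - \<sigma> n') < e" if "0 < e" for e
    using \<sigma> that unfolding MCauchy_def norm_dist_def by meson
  obtain c where c: "0 < c" "\<And>p m. p \<in> S \<Longrightarrow> cmod (p m) \<le> c * N p"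
    using coordinate_bound by meson
  have "\<exists>l. (\<lambda>n. \<sigma> n m) \<longlonglongrightarrow> l" for m
  proof -
    have "Cauchy (\<lambda>n. \<sigma> n m)"
    proof (rule metric_CauchyI)
      fix e :: real assume "0 < e"
      then obtain M where M: "\<And>n n'. n \<ge> M \<Longrightarrow> n' \<ge> M \<Longrightarrow> N (\<sigma> n - \<sigma> n') < e / c"
        using cau[of "e / c"] c(1) by auto
      have "dist (\<sigma> n m) (\<sigma> n' m) < e" if "n \<ge> M" "n' \<ge> M" for n n'
      proof -
        have "dist (\<sigma> n m) (\<sigma> n' m) \<le> c * N (\<sigma> n - \<sigma> n')"
          using c(2)[OF diff_mem[OF mem mem], of n n' m] by (simp add: dist_norm)
        also have "\<dots> < e" using M[OF that] c(1) by (simp add: field_simps)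
        finally show ?thesis .
      qed
      then show "\<exists>M. \<forall>n\<ge>M. \<forall>n'\<ge>M. dist (\<sigma> n m) (\<sigma> n' m) < e" by blast
    qed
    then show ?thesis using Cauchy_convergent_iff convergent_def by blast
  qed
  then obtain p where p: "\<And>m. (\<lambda>n. \<sigma> n m) \<longlonglongrightarrow> p m" by metis
  \<comment> \<open>With \<open>n\<close> fixed, the second index of the Cauchy estimate tends to
    infinity. Membership of the limit \<open>p\<close> is not yet known, so the statement concerns
    the modular and not the norm.\<close>
  have lim: "\<exists>M. \<forall>n\<ge>M. modular_le (\<lambda>m. cmod ((\<sigma> n - p) m) / e) 1" if e: "0 < e" for e
  proof -
    obtain M where M: "\<And>n n'. n \<ge> M \<Longrightarrow> n' \<ge> M \<Longrightarrow> N (\<sigma> n - \<sigma> n') < e"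
      using cau[OF e] by auto
    have "modular_le (\<lambda>m. cmod ((\<sigma> n - p) m) / e) 1" if "n \<ge> M" for n
    proof (rule modular_le_lim)
      show "(\<lambda>i. cmod ((\<sigma> n - \<sigma> i) m) / e) \<longlonglongrightarrow> cmod ((\<sigma> n - p) m) / e" for m
        unfolding fun_diff_def using e by (intro tendsto_intros p) auto
      show "\<forall>\<^sub>F i in sequentially. modular_le (\<lambda>m. cmod ((\<sigma> n - \<sigma> i) m) / e) 1"
        by (rule eventually_mono[OF eventually_ge_at_top[of M]])
          (rule modular_le_of_norm_less[OF diff_mem[OF mem mem] M[OF that]])
    qed (use e in auto)
    then show ?thesis by blast
  qed
  obtain n where "modular_le (\<lambda>m. cmod ((\<sigma> n - p) m) / 1) 1"
    using lim[OF zero_less_one] by blast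
  then have "\<sigma> n - p \<in> S" by (rule in_orlicz_space[OF zero_less_one])
  then have "\<sigma> n - (\<sigma> n - p) \<in> S" by (rule diff_mem[OF mem])
  then have pS: "p \<in> S" by simp
  have "\<exists>M. \<forall>n\<ge>M. \<sigma> n \<in> S \<and> N (\<sigma> n - p) < e" if "0 < e" for e
  proof -
    \<comment> \<open>Halving \<open>e\<close> compensates for the non-strict bound given by
      \<open>norm_le\<close>.\<close>
    obtain M where "\<And>n. n \<ge> M \<Longrightarrow> modular_le (\<lambda>m. cmod ((\<sigma> n - p) m) / (e / 2)) 1"
      using lim[OF half_gt_zero[OF \<open>0 < e\<close>]] by blast
    then have "N (\<sigma> n - p) \<le> e / 2" if "n \<ge> M" for n
      using that by (intro norm_le[OF half_gt_zero[OF \<open>0 < e\<close>]])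
    moreover have "e / 2 < e" using that by simp
    ultimately have "N (\<sigma> n - p) < e" if "n \<ge> M" for n
      using that le_less_trans by blast
    then show ?thesis using mem by blast
  qed
  then show "\<exists>x. limitin mtopology \<sigma> x sequentially"
    using pS unfolding limit_metric_sequentially norm_dist_def by blast
qed

section \<open>Finite heads, small tails and separability\<close>

lemma finite_sum_small:
  assumes "finite F" "0 < e"
  shows "\<exists>d>0. \<forall>a. (\<forall>m\<in>F. 0 \<le> a m \<and> a m \<le> d) \<longrightarrow> (\<Sum>m\<in>F. wt m * \<Phi> (a m)) \<le> e"
proof -
  \<comment> \<open>On the unit interval convexity gives \<open>\<Phi> t \<le> t * \<Phi> 1\<close>,
    so entries up to \<open>e / A\<close> produce at most \<open>e / A * (A - 1)\<close>. The added
    1 makes \<open>A\<close> positive even for empty \<open>F\<close>.\<close>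
  define A where "A = (\<Sum>m\<in>F. wt m) * \<Phi> 1 + 1"
  have A: "0 < A"
    unfolding A_def using wt_pos Phi_pos[of 1] by (intro add_nonneg_pos mult_nonneg_nonneg sum_nonneg) (auto simp: less_imp_le)
  have "(\<Sum>m\<in>F. wt m * \<Phi> (a m)) \<le> e" if a: "\<And>m. m \<in> F \<Longrightarrow> 0 \<le> a m \<and> a m \<le> min 1 (e / A)" for a
  proof -
    have "(\<Sum>m\<in>F. wt m * \<Phi> (a m)) \<le> (\<Sum>m\<in>F. wt m * (e / A * \<Phi> 1))"
    proof (intro sum_mono mult_left_mono)
      fix m assume "m \<in> F"
      have "\<Phi> (a m * 1) \<le> a m * \<Phi> 1"
        using a[OF \<open>m \<in> F\<close>] by (intro Phi_scale_le) auto
      also have "\<dots> \<le> e / A * \<Phi> 1"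
        using a[OF \<open>m \<in> F\<close>] Phi_pos[of 1] by (intro mult_right_mono) auto
      finally show "\<Phi> (a m) \<le> e / A * \<Phi> 1" by simp
    qed (use wt_pos in \<open>simp add: less_imp_le\<close>)
    also have "\<dots> = (\<Sum>m\<in>F. wt m) * (e / A * \<Phi> 1)"
      by (simp only: sum_distrib_right)
    also have "\<dots> = e / A * (A - 1)"
      by (simp add: A_def mult_ac)
    also have "\<dots> \<le> e"
      using A assms(2) by (simp add: field_simps)
    finally show ?thesis .
  qed
  then show ?thesis using A assms(2) by (intro exI[of _ "min 1 (e / A)"]) auto
qed

text \<open>Separability and compactness both use this with two halves: coordinatewise closeness
  controls the head on \<open>F\<close>, and a tail estimate controls everything outside it.\<close>

lemma modular_le_split:
  assumes "finite F" "\<And>m. 0 \<le> a m" "(\<Sum>m\<in>F. wt m * \<Phi> (a m)) \<le> c"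
    and "\<And>G. finite G \<Longrightarrow> G \<inter> F = {} \<Longrightarrow> (\<Sum>m\<in>G. wt m * \<Phi> (a m)) \<le> d"
  shows "modular_le a (c + d)"
  unfolding modular_le_def
proof (intro allI impI)
  fix G :: "int set" assume G: "finite G"
  have "(\<Sum>m\<in>G. wt m * \<Phi> (a m)) = (\<Sum>m\<in>G \<inter> F. wt m * \<Phi> (a m)) + (\<Sum>m\<in>G - F. wt m * \<Phi> (a m))"
    using G by (rule sum.Int_Diff)
  also have "(\<Sum>m\<in>G \<inter> F. wt m * \<Phi> (a m)) \<le> (\<Sum>m\<in>F. wt m * \<Phi> (a m))"
    using assms by (intro sum_mono2 summand_nonneg) auto
  also have "(\<Sum>m\<in>G - F. wt m * \<Phi> (a m)) \<le> d"
    using G by (intro assms(4)) auto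
  finally show "(\<Sum>m\<in>G. wt m * \<Phi> (a m)) \<le> c + d" using assms(3) by linarith
qed

lemma finite_support_mem:
  assumes "finite F" "\<And>m. m \<notin> F \<Longrightarrow> p m = 0"
  shows "p \<in> S"
proof -
  have "modular_le (\<lambda>m. cmod (p m)) ((\<Sum>m\<in>F. wt m * \<Phi> (cmod (p m))) + 0)"
    using assms(2) by (intro modular_le_split[OF assms(1)])
      (auto simp: Phi_0 disjoint_iff intro!: sum_nonpos)
  then show ?thesis
    using orlicz_class_iff class_eq_space by blast
qed

lemma separable: "separable_space mtopology"
proof -
  obtain D :: "complex set" where D: "countable D" "\<And>X. open X \<Longrightarrow> X \<noteq> {} \<Longrightarrow> \<exists>d\<in>D. d \<in> X"
    using countable_dense_exists by meson
  \<comment> \<open>Association lists encode finitely supported sequences, with default value 0 off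
    the listed indices. Lists over a countable set are countable, hence so is
    \<open>K\<close>.\<close>
  define g :: "(int \<times> complex) list \<Rightarrow> int \<Rightarrow> complex"
    where "g xs m = (case map_of xs m of None \<Rightarrow> 0 | Some z \<Rightarrow> z)" for xs m
  define K where "K = g ` lists (UNIV \<times> D)"
  have "countable K"
    unfolding K_def using D(1) by blast
  moreover have KS: "K \<subseteq> S"
  proof
    fix p assume "p \<in> K"
    then obtain xs where "p = g xs" by (auto simp: K_def)
    then show "p \<in> S"
      by (intro finite_support_mem[of "dom (map_of xs)"])
        (auto simp: g_def finite_dom_map_of domIff split: option.splits)
  qed
  moreover have "S \<subseteq> mtopology closure_of K"
  proof
    fix p assume p: "p \<in> S"
    have "\<exists>q\<in>K. q \<in> mball p e" if "0 < e" for e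
    proof -
      define r where "r = e / 2"
      have r: "0 < r" "r < e" using that by (auto simp: r_def)
      obtain c where "modular_le (\<lambda>m. cmod (p m)) c"
        using p class_eq_space orlicz_class_iff by blast
      then obtain c' where "modular_le (\<lambda>m. 1 / r * cmod (p m)) c'"
        using modular_le_scale[of "\<lambda>m. cmod (p m)" c "1 / r"] r by auto
      then obtain F where F: "finite F"
        "\<And>G. finite G \<Longrightarrow> G \<inter> F = {} \<Longrightarrow> (\<Sum>m\<in>G. wt m * \<Phi> (1 / r * cmod (p m))) \<le> 1/2"
        using modular_le_tail[of _ c' "1/2"] by (metis half_gt_zero zero_less_one)
      obtain d where d: "0 < d"
        "\<And>a. (\<forall>m\<in>F. 0 \<le> a m \<and> a m \<le> d) \<Longrightarrow> (\<Sum>m\<in>F. wt m * \<Phi> (a m)) \<le> 1/2"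
        using finite_sum_small[OF F(1), of "1/2"] by auto
      \<comment> \<open>The radius \<open>d * r\<close> makes the error at most \<open>d\<close>
        after division by \<open>r\<close>, which is what the head estimate on \<open>F\<close> asks
        for.\<close>
      have "\<exists>z\<in>D. dist (p m) z < d * r" for m
        using D(2)[OF open_ball, of "p m" "d * r"] mult_pos_pos[OF d(1) r(1)] by auto
      then obtain z where z: "\<And>m. z m \<in> D" "\<And>m. dist (p m) (z m) < d * r" by metis
      obtain ms where ms: "set ms = F" using F(1) finite_list by blast
      define q where "q = g (map (\<lambda>m. (m, z m)) ms)"
      have q: "q m = (if m \<in> F then z m else 0)" for m
        by (simp add: q_def g_def map_of_map_restrict ms restrict_map_def)
      have "q \<in> K"
        unfolding K_def q_def using z(1) by (intro imageI) auto
      have "modular_le (\<lambda>m. cmod ((p - q) m) / r) (1/2 + 1/2)"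
      proof (rule modular_le_split[OF F(1)])
        have "cmod ((p - q) m) / r \<le> d" if "m \<in> F" for m
          using z(2)[of m] that r(1) by (simp add: q dist_norm field_simps)
        then show "(\<Sum>m\<in>F. wt m * \<Phi> (cmod ((p - q) m) / r)) \<le> 1/2"
          using r(1) by (intro d(2)) auto
        fix G assume G: "finite G" "G \<inter> F = {}"
        have "(\<Sum>m\<in>G. wt m * \<Phi> (cmod ((p - q) m) / r)) = (\<Sum>m\<in>G. wt m * \<Phi> (1 / r * cmod (p m)))"
          using G(2) by (intro sum.cong) (auto simp: q)
        then show "(\<Sum>m\<in>G. wt m * \<Phi> (cmod ((p - q) m) / r)) \<le> 1/2"
          using F(2)[OF G] by simp
      qed (use r in auto)
      then have "N (p - q) \<le> r" using r(1) by (intro norm_le) auto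
      then show ?thesis
        using \<open>q \<in> K\<close> KS p r(2) by (intro bexI[of _ q]) (auto simp: norm_dist_def)
    qed
    then show "p \<in> mtopology closure_of K"
      using p by (simp add: metric_closure_of)
  qed
  ultimately show ?thesis
    unfolding separable_space_def
    by (metis closure_of_subset_topspace subset_antisym topspace_mtopology)
qed

end

subsection \<open>Compactness of the embedding\<close>

lemma compact_embedding:
  fixes \<Phi> :: "real \<Rightarrow> real" and k k' :: real and w :: "int \<Rightarrow> real"
  assumes A: "orlicz_weight \<Phi> k w \<delta>" and B: "orlicz_weight \<Phi> k' w \<delta>" and "k < k'"
  shows "compact_linear_operator (orlicz_space k' \<Phi> w) (orlicz_norm k' \<Phi> w)
      (orlicz_space k \<Phi> w) (orlicz_norm k \<Phi> w) (\<lambda>p. p)"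
proof -
  interpret A: orlicz_weight \<Phi> k w \<delta> by (rule A)
  interpret B: orlicz_weight \<Phi> k' w \<delta> by (rule B)
  have base: "1 \<le> 1 + \<Phi> (real_of_int \<bar>m\<bar>)" for m
    using A.Phi_nonneg[of "real_of_int \<bar>m\<bar>"] by simp
  have w_pos: "0 < w m" for m
    using A.wt_pos[of m] base[of m] by (auto simp: A.wt_def zero_less_mult_iff)
  have wt_eq: "A.wt m = (1 + \<Phi> (real_of_int \<bar>m\<bar>)) powr (k - k') * B.wt m" for m
    using base[of m] by (simp add: A.wt_def B.wt_def powr_add[symmetric])
  have wt_le: "A.wt m \<le> B.wt m" for m
    unfolding A.wt_def B.wt_def
    using w_pos[of m] base[of m] \<open>k < k'\<close> by (intro mult_left_mono powr_mono) auto
  have sub: "orlicz_space k' \<Phi> w \<subseteq> orlicz_space k \<Phi> w"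
  proof
    fix p assume "p \<in> orlicz_space k' \<Phi> w"
    then obtain c where c: "B.modular_le (\<lambda>m. cmod (p m)) c"
      using B.class_eq_space B.orlicz_class_iff by blast
    have "A.modular_le (\<lambda>m. cmod (p m)) c"
      unfolding A.modular_le_def
    proof (intro allI impI)
      fix F :: "int set" assume "finite F"
      have "(\<Sum>m\<in>F. A.wt m * \<Phi> (cmod (p m))) \<le> (\<Sum>m\<in>F. B.wt m * \<Phi> (cmod (p m)))"
        by (intro sum_mono mult_right_mono wt_le A.Phi_nonneg) auto
      then show "(\<Sum>m\<in>F. A.wt m * \<Phi> (cmod (p m))) \<le> c"
        using B.modular_leD[OF c \<open>finite F\<close>] by linarith
    qed
    then show "p \<in> orlicz_space k \<Phi> w"
      using A.class_eq_space A.orlicz_class_iff by blast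
  qed
  \<comment> \<open>The ratio of the weights is \<open>1 + \<Phi> \<bar>m\<bar>\<close> raised to
    the negative power \<open>k - k'\<close>. It tends to 0 since \<Phi> is unbounded, so only a
    bounded range of \<open>m\<close> is exceptional.\<close>
  have small_ratio: "finite {m. \<eta> * B.wt m < A.wt m}" if "0 < \<eta>" for \<eta>
  proof -
    have "((\<lambda>t. (1 + \<Phi> t) powr (k - k')) \<longlongrightarrow> 0) at_top"
      using \<open>k < k'\<close> by (intro tendsto_neg_powr filterlim_tendsto_add_at_top[OF tendsto_const A.Phi_at_top]) auto
    then have "\<forall>\<^sub>F t in at_top. (1 + \<Phi> t) powr (k - k') < \<eta>"
      using that by (rule order_tendstoD)
    then obtain T where T: "\<And>t. T \<le> t \<Longrightarrow> (1 + \<Phi> t) powr (k - k') < \<eta>"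
      by (auto simp: eventually_at_top_linorder)
    have "{m. \<eta> * B.wt m < A.wt m} \<subseteq> {-\<lceil>T\<rceil>..\<lceil>T\<rceil>}"
    proof
      fix m assume "m \<in> {m. \<eta> * B.wt m < A.wt m}"
      then have "\<eta> < (1 + \<Phi> (real_of_int \<bar>m\<bar>)) powr (k - k')"
        using B.wt_pos[of m] by (simp add: wt_eq)
      then have "real_of_int \<bar>m\<bar> < T"
        using T[of "real_of_int \<bar>m\<bar>"] by linarith
      then show "m \<in> {-\<lceil>T\<rceil>..\<lceil>T\<rceil>}"
        by (simp add: abs_le_iff) linarith
    qed
    then show ?thesis using finite_subset by blast
  qed
  \<comment> \<open>The set \<open>F\<close> depends only on \<open>R\<close> and \<open>e\<close>;
    its uniformity over all \<open>u\<close> in the modular ball is the core of compactness.\<close>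
  have tail: "\<exists>F. finite F \<and> (\<forall>u. B.modular_le (\<lambda>m. cmod (u m) / R) 1 \<longrightarrow>
      (\<forall>G. finite G \<and> G \<inter> F = {} \<longrightarrow> (\<Sum>m\<in>G. A.wt m * \<Phi> (cmod (u m) / e)) \<le> 1/2))"
    if "0 < R" "0 < e" for R e :: real
  proof -
    obtain C t0 where C: "C > 0" "t0 > 0"
      "\<And>t. 0 \<le> t \<Longrightarrow> t \<le> t0 \<Longrightarrow> \<Phi> (R / e * t) \<le> C * \<Phi> t"
      using A.delta2_scaled[OF less_imp_le[OF divide_pos_pos[OF \<open>0 < R\<close> \<open>0 < e\<close>]]] by blast
    \<comment> \<open>The first bound makes the final factor \<open>\<eta> * C\<close> at most 1/2.
      The second forces every scaled coordinate off \<open>F\<close> below \<open>t0\<close>: a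
      larger one would give \<open>\<delta> * \<Phi> t0 \<le> \<eta>\<close>.\<close>
    define \<eta> where "\<eta> = min (1 / (2 * C)) (\<delta> * \<Phi> t0 / 2)"
    have \<eta>: "0 < \<eta>" "\<eta> * C \<le> 1/2" "\<eta> < \<delta> * \<Phi> t0"
    proof -
      have *: "0 < \<delta> * \<Phi> t0" using A.delta_pos A.Phi_pos[OF C(2)] by simp
      show "0 < \<eta>" "\<eta> < \<delta> * \<Phi> t0" using * C(1) by (auto simp: \<eta>_def min_def)
      have "\<eta> * C \<le> 1 / (2 * C) * C" using C(1) by (intro mult_right_mono) (auto simp: \<eta>_def)
      then show "\<eta> * C \<le> 1/2" using C(1) by simp
    qed
    define F where "F = {m. \<eta> * B.wt m < A.wt m}"
    have "(\<Sum>m\<in>G. A.wt m * \<Phi> (cmod (u m) / e)) \<le> 1/2"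
      if u: "B.modular_le (\<lambda>m. cmod (u m) / R) 1" and G: "finite G" "G \<inter> F = {}" for u G
    proof -
      have "A.wt m * \<Phi> (cmod (u m) / e) \<le> \<eta> * C * (B.wt m * \<Phi> (cmod (u m) / R))" if "m \<in> G" for m
      proof -
        define t where "t = cmod (u m) / R"
        have t: "0 \<le> t" using \<open>0 < R\<close> by (simp add: t_def)
        have m: "A.wt m \<le> \<eta> * B.wt m" using G(2) that by (auto simp: F_def)
        have "t \<le> t0"
        proof (rule ccontr)
          assume "\<not> t \<le> t0"
          then have "\<Phi> t0 \<le> \<Phi> t" using C(2) by (intro A.Phi_mono) auto
          have "\<delta> * \<Phi> t0 \<le> A.wt m * \<Phi> t"
            using A.wt_ge[of m] \<open>\<Phi> t0 \<le> \<Phi> t\<close> A.delta_pos A.Phi_pos[OF C(2)] by (intro mult_mono) auto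
          also have "\<dots> \<le> \<eta> * B.wt m * \<Phi> t"
            using m t by (intro mult_right_mono A.Phi_nonneg)
          also have "\<dots> \<le> \<eta> * 1"
            using B.modular_le_single[OF u, of m] \<eta>(1) unfolding mult.assoc t_def
            by (intro mult_left_mono) auto
          finally show False using \<eta>(3) by simp
        qed
        have "cmod (u m) / e = R / e * t" using \<open>0 < R\<close> by (simp add: t_def)
        then have "A.wt m * \<Phi> (cmod (u m) / e) = A.wt m * \<Phi> (R / e * t)" by (simp only:)
        also have "\<dots> \<le> (\<eta> * B.wt m) * (C * \<Phi> t)"
          using m C(3)[OF t \<open>t \<le> t0\<close>] A.wt_pos[of m] A.Phi_nonneg[of "R / e * t"] t \<open>0 < R\<close> \<open>0 < e\<close>
          by (intro mult_mono) auto
        finally show ?thesis by (simp add: t_def mult_ac)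
      qed
      then have "(\<Sum>m\<in>G. A.wt m * \<Phi> (cmod (u m) / e)) \<le> (\<Sum>m\<in>G. \<eta> * C * (B.wt m * \<Phi> (cmod (u m) / R)))"
        by (rule sum_mono)
      also have "\<dots> = \<eta> * C * (\<Sum>m\<in>G. B.wt m * \<Phi> (cmod (u m) / R))"
        by (simp add: sum_distrib_left)
      also have "\<dots> \<le> \<eta> * C * 1"
        using \<eta>(1) C(1) by (intro mult_left_mono B.modular_leD[OF u G(1)]) auto
      finally show ?thesis using \<eta>(2) by simp
    qed
    then show ?thesis using small_ratio[OF \<eta>(1)] unfolding F_def by blast
  qed
  have "compactin A.mtopology (A.mtopology closure_of B)"
    if B: "B \<subseteq> orlicz_space k' \<Phi> w" "B.mbounded B" for B
  proof -
    obtain b where b: "\<And>p q. p \<in> B \<Longrightarrow> q \<in> B \<Longrightarrow> orlicz_norm k' \<Phi> w (p - q) \<le> b"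
      using B(2) unfolding B.mbounded_alt norm_dist_def by blast
    \<comment> \<open>For empty \<open>B\<close> the bound \<open>b\<close> may be negative, hence
      the absolute value. The added 1 gives the strict inequality that
      \<open>modular_le_of_norm_less\<close> asks for.\<close>
    define R where "R = \<bar>b\<bar> + 1"
    have R: "0 < R" "b < R" by (auto simp: R_def)
    obtain c where c: "0 < c" "\<And>p m. p \<in> orlicz_space k' \<Phi> w \<Longrightarrow> cmod (p m) \<le> c * orlicz_norm k' \<Phi> w p"
      using B.coordinate_bound by meson
    \<comment> \<open>In the complete target space total boundedness yields compact closure, and
      sequentially it only asks for Cauchy subsequences, with no limit to identify.\<close>
    have "A.mtotally_bounded B"
      unfolding A.mtotally_bounded_sequentially
    proof (intro conjI allI impI)
      show "B \<subseteq> orlicz_space k \<Phi> w" using B(1) sub by blast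
      fix \<sigma> :: "nat \<Rightarrow> int \<Rightarrow> complex" assume \<sigma>: "range \<sigma> \<subseteq> B"
      then have \<sigma>B: "\<sigma> n \<in> B" for n by blast
      then have \<sigma>S: "\<sigma> n \<in> orlicz_space k' \<Phi> w" for n using B(1) by blast
      have bound: "cmod (\<sigma> n m - \<sigma> 0 m) \<le> c * b" for n m
      proof -
        have "cmod ((\<sigma> n - \<sigma> 0) m) \<le> c * orlicz_norm k' \<Phi> w (\<sigma> n - \<sigma> 0)"
          by (intro c(2) B.diff_mem \<sigma>S)
        also have "\<dots> \<le> c * b" using c(1) by (intro mult_left_mono b \<sigma>B) auto
        finally show ?thesis by simp
      qed
      \<comment> \<open>Only the differences \<open>\<sigma> n - \<sigma> 0\<close> are bounded uniformly in both index and coordinate.\<close>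
      obtain r where r: "strict_mono r" "\<And>m. \<exists>l. (\<lambda>n. \<sigma> (r n) m - \<sigma> 0 m) \<longlonglongrightarrow> l"
        by (rule function_convergent_subsequence[of UNIV "\<lambda>n m. \<sigma> n m - \<sigma> 0 m" "c * b",
            OF countableI_type bound]) (rule that, auto)
      have cau: "Cauchy (\<lambda>n. \<sigma> (r n) m - \<sigma> 0 m)" for m
        using r(2)[of m] LIMSEQ_imp_Cauchy by blast
      have "\<exists>M. \<forall>i j. M \<le> i \<longrightarrow> M \<le> j \<longrightarrow> orlicz_norm k \<Phi> w (\<sigma> (r i) - \<sigma> (r j)) < e" if "0 < e" for e
      proof -
        define s where "s = e / 2"
        have s: "0 < s" "s < e" using that by (auto simp: s_def)
        obtain F where F: "finite F" "\<And>u G. B.modular_le (\<lambda>m. cmod (u m) / R) 1 \<Longrightarrow> finite G \<Longrightarrow> G \<inter> F = {} \<Longrightarrow>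
            (\<Sum>m\<in>G. A.wt m * \<Phi> (cmod (u m) / s)) \<le> 1/2"
          using tail[OF R(1) s(1)] by blast
        obtain d where d: "0 < d"
          "\<And>a. (\<forall>m\<in>F. 0 \<le> a m \<and> a m \<le> d) \<Longrightarrow> (\<Sum>m\<in>F. A.wt m * \<Phi> (a m)) \<le> 1/2"
          using A.finite_sum_small[OF F(1), of "1/2"] by auto
        have "\<exists>M. \<forall>i\<ge>M. \<forall>j\<ge>M. cmod (\<sigma> (r i) m - \<sigma> (r j) m) < d * s" for m
          using metric_CauchyD[OF cau[of m], of "d * s"] d(1) s(1) by (simp add: dist_norm)
        then obtain M where M: "\<And>m i j. M m \<le> i \<Longrightarrow> M m \<le> j \<Longrightarrow> cmod (\<sigma> (r i) m - \<sigma> (r j) m) < d * s"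
          by metis
        \<comment> \<open>Only coordinates in \<open>F\<close> need to be close, so the largest of
          their finitely many thresholds suffices. For empty \<open>F\<close> the unspecified value
          of \<open>Max\<close> is harmless, as no coordinate is involved.\<close>
        have "orlicz_norm k \<Phi> w (\<sigma> (r i) - \<sigma> (r j)) < e" if ij: "Max (M ` F) \<le> i" "Max (M ` F) \<le> j" for i j
        proof -
          define u where "u = \<sigma> (r i) - \<sigma> (r j)"
          have "A.modular_le (\<lambda>m. cmod (u m) / s) (1/2 + 1/2)"
          proof (rule A.modular_le_split[OF F(1)])
            have "cmod (u m) / s \<le> d" if "m \<in> F" for m
            proof -
              have "M m \<le> Max (M ` F)" using F(1) that by simp
              then have "cmod (u m) < d * s"
                unfolding u_def using M[of m i j] ij by simp
              then show ?thesis using s(1) by (simp add: field_simps)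
            qed
            then show "(\<Sum>m\<in>F. A.wt m * \<Phi> (cmod (u m) / s)) \<le> 1/2"
              using s(1) by (intro d(2)) auto
            have "orlicz_norm k' \<Phi> w u < R"
              using b[OF \<sigma>B \<sigma>B, of "r i" "r j"] R(2) unfolding u_def by linarith
            then have "B.modular_le (\<lambda>m. cmod (u m) / R) 1"
              unfolding u_def by (intro B.modular_le_of_norm_less B.diff_mem \<sigma>S)
            then show "(\<Sum>m\<in>G. A.wt m * \<Phi> (cmod (u m) / s)) \<le> 1/2" if "finite G" "G \<inter> F = {}" for G
              using F(2) that by blast
          qed (use s in auto)
          then have "orlicz_norm k \<Phi> w u \<le> s"
            using s(1) by (intro A.norm_le) auto
          then show ?thesis using s(2) by (simp add: u_def)
        qed
        then show ?thesis by blast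
      qed
      then have "A.MCauchy (\<sigma> \<circ> r)"
        unfolding A.MCauchy_def norm_dist_def using \<sigma>S sub by auto
      then show "\<exists>r. strict_mono r \<and> A.MCauchy (\<sigma> \<circ> r)" using r(1) by blast
    qed
    then show ?thesis
      using A.mtotally_bounded_eq_compact_closure_of[OF A.complete] by blast
  qed
  then show ?thesis
    unfolding compact_linear_operator_def using A.normed_space B.normed_space sub by auto
qed

theorem theorem4:
  fixes \<Phi> :: "real \<Rightarrow> real" and k :: real and w :: "int \<Rightarrow> real"
  assumes "orlicz_function \<Phi>"
    and "Limsup (at_right 0) (\<lambda>t. ereal (\<Phi> (2 * t) / \<Phi> t)) < \<infinity>"
    and "k \<ge> 0"
    and "\<And>m. w m > 0"
    and "(INF m. w m) > 0"
  shows "(small_orlicz_space k \<Phi> w = orlicz_class k \<Phi> w \<and>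
      orlicz_class k \<Phi> w = orlicz_space k \<Phi> w \<and>
      banach_seq_space (small_orlicz_space k \<Phi> w) (orlicz_norm k \<Phi> w) \<and>
      separable_space (norm_topology (small_orlicz_space k \<Phi> w) (orlicz_norm k \<Phi> w)) \<and>
      small_orlicz_space k \<Phi> w =
        {p. (\<Sum>\<^sub>\<infinity>m\<in>UNIV. ennreal (w m * (1 + \<Phi> (real_of_int \<bar>m\<bar>)) powr k * \<Phi> (cmod (p m)))) < \<infinity>}) \<and>
    (\<forall>k'>k. compact_linear_operator
      (small_orlicz_space k' \<Phi> w) (orlicz_norm k' \<Phi> w)
      (small_orlicz_space k \<Phi> w) (orlicz_norm k \<Phi> w) (\<lambda>p. p))"
proof -
  \<comment> \<open>For nonnegative \<open>j\<close> the power is at least 1, so the infimum of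
    \<open>w\<close> bounds the full weight from below. The same constant therefore serves
    \<open>k\<close> and every \<open>k'\<close> above it.\<close>
  have weight: "orlicz_weight \<Phi> j w (INF m. w m)" if "0 \<le> j" for j
  proof
    fix m
    have "(INF m. w m) \<le> w m"
      using assms(4) by (intro cINF_lower bdd_belowI[of _ 0]) (auto simp: less_imp_le)
    moreover have "1 \<le> (1 + \<Phi> (real_of_int \<bar>m\<bar>)) powr j"
      using assms(1) that by (intro ge_one_powr_ge_zero) (auto simp: orlicz_function_def Pi_iff)
    ultimately show "(INF m. w m) \<le> w m * (1 + \<Phi> (real_of_int \<bar>m\<bar>)) powr j"
      using assms(4)[of m] by (smt (verit) mult_le_cancel_left1)
  qed (use assms in auto)
  interpret orlicz_weight \<Phi> k w "INF m. w m"
    using assms(3) by (rule weight)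
  have small: "small_orlicz_space j \<Phi> w = orlicz_space j \<Phi> w" if "0 \<le> j" for j
    using orlicz_weight.small_eq_class[OF weight[OF that]] orlicz_weight.class_eq_space[OF weight[OF that]]
    by simp
  have "\<forall>k'>k. compact_linear_operator (small_orlicz_space k' \<Phi> w) (orlicz_norm k' \<Phi> w)
      (small_orlicz_space k \<Phi> w) (orlicz_norm k \<Phi> w) (\<lambda>p. p)"
    using compact_embedding[OF weight weight] small assms(3) by simp
  moreover have "banach_seq_space (small_orlicz_space k \<Phi> w) (orlicz_norm k \<Phi> w)"
    "separable_space (norm_topology (small_orlicz_space k \<Phi> w) (orlicz_norm k \<Phi> w))"
    using normed_space complete separable small[OF assms(3)] by (simp_all add: banach_seq_space_def)
  moreover have "small_orlicz_space k \<Phi> w =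
      {p. (\<Sum>\<^sub>\<infinity>m\<in>UNIV. ennreal (w m * (1 + \<Phi> (real_of_int \<bar>m\<bar>)) powr k * \<Phi> (cmod (p m)))) < \<infinity>}"
    unfolding small_eq_class orlicz_class_def orlicz_sum_def ..
  ultimately show ?thesis
    using small_eq_class class_eq_space by blast
qed

end
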